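(* Let $\mathcal{Q}$ be a finite classical polar space of rank $r\ge 1$, type $Q$ and parameter $\epsilon$ over $\mathbb{F}_q$, let $0\le t\le k\le r$, let $D$ be a $t$-$(r,k,\lambda)_Q$ design in $\mathcal{Q}$, and let $S$ be a subspace of $\mathcal{Q}$ of dimension $s=\dim(S)$. For $j\in\{0,\ldots,k\}$ let $\alpha_j=\#\{B\in D\mid \dim(B\cap S)=j\}$, and for $j\in\{0,\ldots,t\}$ let $\lambda_j=\lambda\cdot\begin{bmatrix} r-j\\ t-j\end{bmatrix}_Q\Big/\begin{bmatrix} k-j\\ t-j\end{bmatrix}_q$. Then for every $i\in\{0,\ldots,t\}$, $$\alpha_i=\begin{bmatrix} s\\ i\end{bmatrix}_q\sum_{j=i}^{t}(-1)^{j-i}q^{\binom{j-i}{2}}\begin{bmatrix} s-i\\ j-i\end{bmatrix}_q\lambda_j+(-1)^{t+1-i}q^{\binom{t+1-i}{2}}\sum_{j=t+1}^{k}\begin{bmatrix} j\\ i\end{bmatrix}_q\begin{bmatrix} j-i-1\\ t-i\end{bmatrix}_q\alpha_j.$$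
   Context: Let $q$ be a prime power. A finite classical polar space $\mathcal{Q}$ over $\mathbb{F}_q$ consists of all subspaces of a finite-dimensional $\mathbb{F}_q$-vector space $V$, $n=\dim V$, that are totally isotropic (resp. totally singular) with respect to a non-degenerate alternating or Hermitian form (resp. a non-singular quadratic form) on $V$. All dimensions are vector space dimensions. The rank $r$ is the maximal dimension of a subspace in $\mathcal{Q}$. The type $Q$ of $\mathcal{Q}$ (kind of form together with $q$) and its parameter $\epsilon$ are: symplectic $\mathrm{Sp}(q)$ ($n=2r$, $\epsilon=0$); Hermitian $U^+(q)$ ($q$ a square, $n=2r$, $\epsilon=-1/2$); Hermitian $U^-(q)$ ($q$ a square, $n=2r+1$, $\epsilon=1/2$); hyperbolic $\Omega^+(q)$ ($n=2r$, $\epsilon=-1$); parabolic $\Omega(q)$ ($n=2r+1$, $\epsilon=0$); elliptic $\Omega^-(q)$ ($n=2r+2$, $\epsilon=1$). $\begin{bmatrix} m\\ k\end{bmatrix}_q$ is the Gaussian binomial coefficient (number of $k$-dimensional subspaces of $\mathbb{F}_q^m$, and $0$ if $k<0$ or $k>m$). $\begin{bmatrix} m\\ k\end{bmatrix}_Q=\begin{bmatrix} m\\ k\end{bmatrix}_q\prod_{i=m-k+1}^{m}(q^{i+\epsilon}+1)$ is the number of $k$-dimensional subspaces in a polar space of type $Q$ and rank $m$. If $i>s$, the first summand on the right-hand side is $0$ because $\begin{bmatrix} s\\ i\end{bmatrix}_q=0$. For $t,k\in\{0,\ldots,r\}$ and an integer $\lambda\ge 0$, a $t$-$(r,k,\lambda)_Q$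 design in $\mathcal{Q}$ is a set $D$ of $k$-dimensional subspaces of $\mathcal{Q}$ (called blocks) such that every $t$-dimensional subspace of $\mathcal{Q}$ is contained in exactly $\lambda$ elements of $D$. *)

theory Defs
  imports Complex_Main "HOL-Library.Cardinality"
begin

section \<open>Types of finite classical polar spaces\<close>

text \<open>In group-theoretic notation: \<open>Sp(q)\<close>, \<open>U\<^sup>+(q)\<close>, \<open>U\<^sup>-(q)\<close>, \<open>\<Omega>\<^sup>+(q)\<close>, \<open>\<Omega>(q)\<close>, \<open>\<Omega>\<^sup>-(q)\<close>.\<close>

datatype polar_type =
  Symplectic | Hermitian_plus | Hermitian_minus | Hyperbolic | Parabolic | Elliptic

fun epsilon :: "polar_type \<Rightarrow> real" where
  "epsilon Symplectic = 0"
| "epsilon Hermitian_plus = - 1 / 2"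
| "epsilon Hermitian_minus = 1 / 2"
| "epsilon Hyperbolic = - 1"
| "epsilon Parabolic = 0"
| "epsilon Elliptic = 1"

fun ambient_dim :: "polar_type \<Rightarrow> nat \<Rightarrow> nat" where
  "ambient_dim Symplectic r = 2 * r"
| "ambient_dim Hermitian_plus r = 2 * r"
| "ambient_dim Hermitian_minus r = 2 * r + 1"
| "ambient_dim Hyperbolic r = 2 * r"
| "ambient_dim Parabolic r = 2 * r + 1"
| "ambient_dim Elliptic r = 2 * r + 2"


section \<open>Gaussian binomial coefficients\<close>

text \<open>For \<open>k > m\<close> the factor with \<open>i = m\<close> vanishes, so the coefficient is \<open>0\<close>; the truncated
  subtraction \<open>m - i\<close> only occurs in factors of such a product.\<close>

definition gauss_binomial :: "nat \<Rightarrow> nat \<Rightarrow> nat \<Rightarrow> real" where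
  "gauss_binomial q m k = (\<Prod>i<k. (real q ^ (m - i) - 1) / (real q ^ (i + 1) - 1))"

lemma gauss_binomial_eq_0: "m < k \<Longrightarrow> gauss_binomial q m k = 0"
  by (auto simp: gauss_binomial_def intro!: prod_zero bexI[of _ m])

text \<open>The exponent \<open>i + \<epsilon>\<close> is a half-integer in the Hermitian case, hence \<open>powr\<close>.\<close>

definition polar_binomial :: "nat \<Rightarrow> polar_type \<Rightarrow> nat \<Rightarrow> nat \<Rightarrow> real" where
  "polar_binomial q Q m k =
     gauss_binomial q m k * (\<Prod>i = m - k + 1..m. real q powr (real i + epsilon Q) + 1)"


section \<open>Forms, polar spaces and designs\<close>

context finite_dimensional_vector_space
begin

definition bilinear_form :: "('b \<Rightarrow> 'b \<Rightarrow> 'a) \<Rightarrow> bool" where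
  "bilinear_form f \<longleftrightarrow>
     (\<forall>y. Vector_Spaces.linear scale (*) (\<lambda>x. f x y)) \<and>
     (\<forall>x. Vector_Spaces.linear scale (*) (f x))"

definition alternating_form :: "('b \<Rightarrow> 'b \<Rightarrow> 'a) \<Rightarrow> bool" where
  "alternating_form f \<longleftrightarrow> bilinear_form f \<and> (\<forall>x. f x x = 0)"

text \<open>Over \<open>\<bbbF>\<^sub>q\<close> with \<open>q = q\<^sub>0\<^sup>2\<close> the involutory automorphism is \<open>a \<mapsto> a ^ q\<^sub>0\<close>. Semilinearity in the
  second argument follows from linearity in the first one and Hermitian symmetry.\<close>

definition hermitian_form :: "('b \<Rightarrow> 'b \<Rightarrow> 'a) \<Rightarrow> bool" where
  "hermitian_form f \<longleftrightarrow>
     (\<exists>q0. q0\<^sup>2 = CARD('a) \<and>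
       (\<forall>y. Vector_Spaces.linear scale (*) (\<lambda>x. f x y)) \<and>
       (\<forall>x y. f y x = f x y ^ q0))"

definition nondegenerate :: "('b \<Rightarrow> 'b \<Rightarrow> 'a) \<Rightarrow> bool" where
  "nondegenerate f \<longleftrightarrow> (\<forall>x. (\<forall>y. f x y = 0) \<longrightarrow> x = 0)"

definition polar_form :: "('b \<Rightarrow> 'a) \<Rightarrow> 'b \<Rightarrow> 'b \<Rightarrow> 'a" where
  "polar_form g x y = g (x + y) - g x - g y"

definition quadratic_form :: "('b \<Rightarrow> 'a) \<Rightarrow> bool" where
  "quadratic_form g \<longleftrightarrow> (\<forall>a x. g (scale a x) = a\<^sup>2 * g x) \<and> bilinear_form (polar_form g)"

text \<open>In characteristic 2 and odd dimension the polar form itself is always degenerate, so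
  non-singularity only asks that its radical contains no nonzero singular vector.\<close>

definition nonsingular :: "('b \<Rightarrow> 'a) \<Rightarrow> bool" where
  "nonsingular g \<longleftrightarrow> (\<forall>x. g x = 0 \<and> (\<forall>y. polar_form g x y = 0) \<longrightarrow> x = 0)"

definition totally_isotropic_subspaces :: "('b \<Rightarrow> 'b \<Rightarrow> 'a) \<Rightarrow> 'b set set" where
  "totally_isotropic_subspaces f = {U. subspace U \<and> (\<forall>x\<in>U. \<forall>y\<in>U. f x y = 0)}"

definition totally_singular_subspaces :: "('b \<Rightarrow> 'a) \<Rightarrow> 'b set set" where
  "totally_singular_subspaces g = {U. subspace U \<and> (\<forall>x\<in>U. g x = 0)}"

definition symplectic_space :: "'b set set \<Rightarrow> bool" where
  "symplectic_space P \<longleftrightarrow>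
     (\<exists>f. alternating_form f \<and> nondegenerate f \<and> P = totally_isotropic_subspaces f)"

definition hermitian_space :: "'b set set \<Rightarrow> bool" where
  "hermitian_space P \<longleftrightarrow>
     (\<exists>f. hermitian_form f \<and> nondegenerate f \<and> P = totally_isotropic_subspaces f)"

definition orthogonal_space :: "'b set set \<Rightarrow> bool" where
  "orthogonal_space P \<longleftrightarrow>
     (\<exists>g. quadratic_form g \<and> nonsingular g \<and> P = totally_singular_subspaces g)"

definition polar_rank :: "'b set set \<Rightarrow> nat" where
  "polar_rank P = Max (dim ` P)"

text \<open>A polar space is represented by the set \<open>P\<close> of its subspaces; its type is determined by the
  kind of form together with the relation between rank and ambient dimension.\<close>

definition polar_space :: "polar_type \<Rightarrow> nat \<Rightarrow> 'b set set \<Rightarrow> bool" where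
  "polar_space Q r P \<longleftrightarrow>
     (case Q of
        Symplectic \<Rightarrow> symplectic_space P
      | Hermitian_plus \<Rightarrow> hermitian_space P
      | Hermitian_minus \<Rightarrow> hermitian_space P
      | Hyperbolic \<Rightarrow> orthogonal_space P
      | Parabolic \<Rightarrow> orthogonal_space P
      | Elliptic \<Rightarrow> orthogonal_space P) \<and>
     polar_rank P = r \<and> dim (UNIV :: 'b set) = ambient_dim Q r"

definition polar_design :: "'b set set \<Rightarrow> nat \<Rightarrow> nat \<Rightarrow> nat \<Rightarrow> 'b set set \<Rightarrow> bool" where
  "polar_design P t k l D \<longleftrightarrow>
     D \<subseteq> {B \<in> P. dim B = k} \<and>
     (\<forall>T\<in>P. dim T = t \<longrightarrow> card {B \<in> D. T \<subseteq> B} = l)"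

end

end

theory Submission
  imports Defs "HOL-Algebra.Sylow" "HOL-Computational_Algebra.Primes" "HOL-Computational_Algebra.Polynomial"
begin

text \<open>Double counting pairs \<open>J \<subseteq> B\<close> with \<open>J\<close> an \<open>i\<close>-dimensional subspace of \<open>S\<close> and \<open>B\<close> a block gives
  \<open>\<Sum>j. [j, i] \<alpha> j = [s, i] \<Lambda> i\<close> for \<open>i \<le> t\<close>. Taking alternating \<open>q\<close>-binomial combinations of these
  equations inverts the system up to the unknowns \<open>\<alpha> j\<close> with \<open>j > t\<close>, whose coefficients are incomplete
  alternating sums of Gaussian binomials.

  That \<open>\<Lambda> i\<close> counts the blocks through an \<open>i\<close>-dimensional \<open>J\<close> rests on the number of \<open>t\<close>-dimensional
  members of the polar space above \<open>J\<close>, which is obtained without Witt's theorem or the classification: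
  if \<open>x\<close> is singular and not orthogonal to \<open>v\<close>, the line \<open>v + c x\<close> carries \<open>e\<close> singular vectors, where
  \<open>e = q\<close>, \<open>\<surd>q\<close>, \<open>1\<close> for alternating, Hermitian, quadratic forms. Hence the number of singular vectors in
  the orthogonal space of \<open>J\<close>, minus \<open>e / q\<close> times the size of that space, does not depend on \<open>J\<close> at all,
  and it can be evaluated at a \<open>J\<close> of maximal dimension.\<close>

section \<open>Identities for Gaussian binomial coefficients\<close>

lemma gauss_binomial_0 [simp]: "gauss_binomial q m 0 = 1"
  by (simp add: gauss_binomial_def)

lemma gauss_binomial_Suc:
  assumes "q \<ge> 2"
  shows "gauss_binomial q m (Suc k) * (real q ^ Suc k - 1) = gauss_binomial q m k * (real q ^ (m - k) - 1)"
proof -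
  have "real q ^ Suc k > 1" using assms by (intro one_less_power) auto
  then show ?thesis by (simp add: gauss_binomial_def)
qed

lemma gauss_binomial_Suc_Suc:
  assumes "q \<ge> 2"
  shows "gauss_binomial q (Suc m) (Suc k) * (real q ^ Suc k - 1) = (real q ^ Suc m - 1) * gauss_binomial q m k"
proof -
  have ne: "real q ^ Suc i \<noteq> 1" for i
    using one_less_power[of "real q" "Suc i"] assms by auto
  have "(\<Prod>i<k. real q ^ (i + 1) - 1) * (real q ^ Suc k - 1) \<noteq> 0"
    using ne by auto
  moreover have "(\<Prod>i<Suc k. real q ^ (Suc m - i) - 1) = (real q ^ Suc m - 1) * (\<Prod>i<k. real q ^ (m - i) - 1)"
    by (subst prod.lessThan_Suc_shift) simp
  ultimately show ?thesis
    by (simp add: gauss_binomial_def prod_dividef divide_simps)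
qed

lemma gauss_binomial_pos:
  assumes "q \<ge> 2" "k \<le> m"
  shows "gauss_binomial q m k > 0"
proof -
  have "real q ^ (m - i) > 1" "real q ^ (i + 1) > 1" if "i < k" for i
    using that assms by (auto intro!: one_less_power simp del: power_Suc)
  then show ?thesis
    unfolding gauss_binomial_def by (intro prod_pos) simp
qed

text \<open>Multiplied by \<open>q ^ Suc k - 1\<close>, every term becomes a multiple of
  \<open>gauss_binomial q m k\<close>, and \<open>q ^ Suc k * q ^ (m - k) = q ^ Suc m\<close> closes
  the computation.\<close>

lemma gauss_binomial_pascal:
  assumes "q \<ge> 2"
  shows "gauss_binomial q (Suc m) (Suc k) = gauss_binomial q m k + real q ^ Suc k * gauss_binomial q m (Suc k)"
proof (cases "k \<le> m")
  case True
  have *: "real q ^ Suc k - 1 \<noteq> 0"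
    using one_less_power[of "real q" "Suc k"] assms by auto
  have e: "real q ^ Suc k * real q ^ (m - k) = real q ^ Suc m"
    using True by (simp flip: power_add)
  have "(gauss_binomial q m k + real q ^ Suc k * gauss_binomial q m (Suc k)) * (real q ^ Suc k - 1)
      = gauss_binomial q m k * (real q ^ Suc k - 1)
        + real q ^ Suc k * (gauss_binomial q m (Suc k) * (real q ^ Suc k - 1))"
    by (simp add: algebra_simps)
  also have "\<dots> = gauss_binomial q m k * (real q ^ Suc k * real q ^ (m - k) - 1)"
    unfolding gauss_binomial_Suc[OF assms] by (simp add: algebra_simps)
  also have "\<dots> = gauss_binomial q (Suc m) (Suc k) * (real q ^ Suc k - 1)"
    unfolding e gauss_binomial_Suc_Suc[OF assms] by simp
  finally show ?thesis using * by simp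
qed (simp add: gauss_binomial_eq_0)

section \<open>Factorial formula, flags and truncated inversion\<close>

lemma gauss_factorial_nonzero:
  assumes "q \<ge> 2"
  shows "(\<Prod>i<n. real q ^ Suc i - 1) \<noteq> 0"
proof -
  have "real q ^ Suc i > 1" for i using assms by (intro one_less_power) auto
  then show ?thesis by (auto simp: less_imp_neq[symmetric] simp del: power_Suc)
qed

text \<open>The q-factorial quotient formula without division: the product over \<open>i<n\<close>
  is the q-factorial of \<open>n\<close> times \<open>(q - 1) ^ n\<close>, and these powers
  balance.\<close>

lemma gauss_binomial_factorial:
  assumes "q \<ge> 2" "k \<le> m"
  shows "gauss_binomial q m k * (\<Prod>i<k. real q ^ Suc i - 1) * (\<Prod>i<m - k. real q ^ Suc i - 1)
       = (\<Prod>i<m. real q ^ Suc i - 1)"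
  using assms(2)
proof (induction k arbitrary: m)
  case (Suc k)
  then obtain m' where m: "m = Suc m'" "k \<le> m'" by (cases m) auto
  have "gauss_binomial q m (Suc k) * (\<Prod>i<Suc k. real q ^ Suc i - 1) * (\<Prod>i<m - Suc k. real q ^ Suc i - 1)
      = (gauss_binomial q (Suc m') (Suc k) * (real q ^ Suc k - 1))
        * (\<Prod>i<k. real q ^ Suc i - 1) * (\<Prod>i<m' - k. real q ^ Suc i - 1)"
    by (simp add: m mult_ac)
  also have "\<dots> = (\<Prod>i<m. real q ^ Suc i - 1)"
    unfolding gauss_binomial_Suc_Suc[OF assms(1)]
    using Suc.IH[OF m(2)] by (simp add: m mult_ac)
  finally show ?case .
qed simp

text \<open>Both sides count flags of an \<open>i\<close>-dimensional inside an
  \<open>l\<close>-dimensional subspace of a \<open>j\<close>-dimensional space. The proof cancels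
  q-factorials; for \<open>l > j\<close> both sides vanish.\<close>

lemma gauss_binomial_trinomial:
  assumes "q \<ge> 2" "i \<le> l"
  shows "gauss_binomial q j l * gauss_binomial q l i = gauss_binomial q j i * gauss_binomial q (j - i) (l - i)"
proof (cases "l \<le> j")
  case True
  define F where "F n = (\<Prod>i<n. real q ^ Suc i - 1)" for n
  have nz: "F n \<noteq> 0" for n
    unfolding F_def by (rule gauss_factorial_nonzero[OF assms(1)])
  have fact: "gauss_binomial q m k = F m / (F k * F (m - k))" if "k \<le> m" for m k
    using gauss_binomial_factorial[OF assms(1) that] nz unfolding F_def[symmetric] by (simp add: field_simps)
  have "j - i - (l - i) = j - l" using assms True by simp
  then show ?thesis
    using assms True nz by (simp add: fact field_simps)
qed (use assms(2) in \<open>cases "j < i"; simp add: gauss_binomial_eq_0\<close>)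

text \<open>The q-Pascal rule splits each new summand into two terms, one of which cancels the
  previous partial sum.\<close>

lemma gauss_binomial_partial_alternating_sum:
  assumes "q \<ge> 2"
  shows "(\<Sum>u\<le>T. (-1) ^ u * real q ^ (u choose 2) * gauss_binomial q (Suc N) u)
       = (-1) ^ T * real q ^ (Suc T choose 2) * gauss_binomial q N T"
proof (induction T)
  case (Suc T)
  have "Suc (Suc T) choose 2 = (Suc T choose 2) + Suc T"
    by (simp add: numeral_2_eq_2)
  then show ?case
    unfolding sum.atMost_Suc Suc.IH gauss_binomial_pascal[OF assms, of N T]
    by (simp add: algebra_simps power_add)
qed (simp add: numeral_2_eq_2)

text \<open>After exchanging the sums, the coefficient \<open>c j\<close> of
  \<open>\<alpha> j\<close> is \<open>gauss_binomial q j i\<close> times a truncated alternating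
  sum. It is 1 for \<open>j = i\<close>, vanishes for all other \<open>j \<le> t\<close>, and has a
  closed form for \<open>j > t\<close>.\<close>

lemma gauss_binomial_partial_inversion:
  fixes \<alpha> :: "nat \<Rightarrow> real"
  assumes q: "q \<ge> 2" and "i \<le> t" "t \<le> k"
  shows "(\<Sum>l = i..t. (-1) ^ (l - i) * real q ^ ((l - i) choose 2) * gauss_binomial q l i *
            (\<Sum>j\<le>k. gauss_binomial q j l * \<alpha> j))
       = \<alpha> i + (-1) ^ (t - i) * real q ^ ((t + 1 - i) choose 2) *
          (\<Sum>j = t + 1..k. gauss_binomial q j i * gauss_binomial q (j - i - 1) (t - i) * \<alpha> j)"
proof -
  define c where "c j = (\<Sum>l = i..t. (-1) ^ (l - i) * real q ^ ((l - i) choose 2) *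
    (gauss_binomial q j l * gauss_binomial q l i))" for j
  have c: "c j = gauss_binomial q j i * (\<Sum>u\<le>t - i. (-1) ^ u * real q ^ (u choose 2) * gauss_binomial q (j - i) u)" for j
  proof -
    have "c j = (\<Sum>l = i..t. gauss_binomial q j i *
        ((-1) ^ (l - i) * real q ^ ((l - i) choose 2) * gauss_binomial q (j - i) (l - i)))"
      unfolding c_def by (intro sum.cong refl, subst gauss_binomial_trinomial[OF q]) auto
    also have "\<dots> = (\<Sum>u\<le>t - i. gauss_binomial q j i *
        ((-1) ^ u * real q ^ (u choose 2) * gauss_binomial q (j - i) u))"
      by (rule sum.reindex_bij_witness[of _ "\<lambda>u. u + i" "\<lambda>l. l - i"]) (use assms in auto)
    finally show ?thesis by (simp add: sum_distrib_left)
  qed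
  have c_less: "c j = 0" if "j < i" for j
    using that by (simp add: c gauss_binomial_eq_0)
  have c_greater: "c j = (-1) ^ (t - i) * real q ^ ((t + 1 - i) choose 2) *
      (gauss_binomial q j i * gauss_binomial q (j - i - 1) (t - i))" if "j > i" for j
  proof -
    have "j - i = Suc (j - i - 1)" "t + 1 - i = Suc (t - i)" using that assms by auto
    then show ?thesis
      using gauss_binomial_partial_alternating_sum[OF q, of "j - i - 1" "t - i"] by (simp add: c)
  qed
  have c_eq: "c i = 1"
  proof -
    have "(\<Sum>u\<le>t - i. (-1) ^ u * real q ^ (u choose 2) * gauss_binomial q 0 u)
        = (\<Sum>u\<in>{0}. (-1) ^ u * real q ^ (u choose 2) * gauss_binomial q 0 u)"
      by (rule sum.mono_neutral_right) (auto simp: gauss_binomial_eq_0)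
    moreover have "gauss_binomial q i i = 1"
      using gauss_binomial_factorial[OF q, of i i] gauss_factorial_nonzero[OF q, of i] by simp
    ultimately show ?thesis by (simp add: c numeral_2_eq_2)
  qed
  have "(\<Sum>l = i..t. (-1) ^ (l - i) * real q ^ ((l - i) choose 2) * gauss_binomial q l i *
            (\<Sum>j\<le>k. gauss_binomial q j l * \<alpha> j)) = (\<Sum>j\<le>k. c j * \<alpha> j)"
    unfolding c_def sum_distrib_left sum_distrib_right
    by (subst sum.swap) (simp add: mult_ac)
  also have "\<dots> = (\<Sum>j\<in>insert i {t + 1..k}. c j * \<alpha> j)"
  proof (rule sum.mono_neutral_right)
    \<comment> \<open>For \<open>i < j \<le> t\<close> the factor
      \<open>gauss_binomial q (j - i - 1) (t - i)\<close> is zero, as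
      \<open>j - i - 1 < t - i\<close>.\<close>
    have "c j = 0" if "j \<noteq> i" "j \<le> t" for j
      using that c_less c_greater by (cases "j < i") (auto simp: gauss_binomial_eq_0)
    then show "\<forall>j\<in>{..k} - insert i {t + 1..k}. c j * \<alpha> j = 0" by auto
  qed (use assms in auto)
  also have "\<dots> = \<alpha> i + (\<Sum>j=t+1..k. c j * \<alpha> j)"
    using assms by (subst sum.insert) (auto simp: c_eq)
  also have "(\<Sum>j=t+1..k. c j * \<alpha> j) = (-1) ^ (t - i) * real q ^ ((t + 1 - i) choose 2) *
          (\<Sum>j = t + 1..k. gauss_binomial q j i * gauss_binomial q (j - i - 1) (t - i) * \<alpha> j)"
    unfolding sum_distrib_left using assms by (intro sum.cong) (auto simp: c_greater)
  finally show ?thesis .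
qed

section \<open>Finite fields\<close>

lemma card_eq_card_image_mult:
  assumes "finite A" "\<And>x. x \<in> A \<Longrightarrow> card {y \<in> A. h y = h x} = n"
  shows "card A = card (h ` A) * n"
proof -
  have "card A = (\<Sum>z\<in>h ` A. card {y \<in> A. h y = z})"
    using assms(1) by (subst card_eq_sum, subst sum.image_gen[OF assms(1), of _ h]) simp
  also have "\<dots> = (\<Sum>z\<in>h ` A. n)"
    using assms(2) by (intro sum.cong) auto
  finally show ?thesis by simp
qed

text \<open>Each fibre of \<open>h\<close> on \<open>A\<close> is a translate of \<open>K\<close>:
  the counting form of the first isomorphism theorem. Comparing values only through differences
  covers values in restricted functions as well as in the field.\<close>

lemma card_additive_image:
  fixes A :: "'a::ab_group_add set"
  assumes "finite A" "\<And>x y. x \<in> A \<Longrightarrow> y \<in> A \<Longrightarrow> x + y \<in> A"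
    "\<And>x y. x \<in> A \<Longrightarrow> y \<in> A \<Longrightarrow> h x = h y \<longleftrightarrow> x - y \<in> K" "K \<subseteq> A"
  shows "card A = card (h ` A) * card K"
proof (rule card_eq_card_image_mult[OF assms(1)])
  fix x assume x: "x \<in> A"
  have "bij_betw (\<lambda>k. k + x) K {y \<in> A. h y = h x}"
    by (rule bij_betw_byWitness[where f' = "\<lambda>y. y - x"]) (use x assms in \<open>auto simp: subset_iff\<close>)
  then show "card {y \<in> A. h y = h x} = card K"
    by (simp add: bij_betw_same_card)
qed

section \<open>Characteristic and Frobenius powers\<close>

lemma prime_CHAR_finite_field: "prime CHAR('a::{field,finite})"
  by (rule prime_CHAR_semidom) (rule finite_imp_CHAR_pos, simp)

text \<open>For a prime divisor \<open>l\<close> of the order, Cauchy's theorem yields a subgroup of order \<open>l\<close> of the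
  additive group; its elements are annihilated by \<open>l\<close> as well as by the characteristic.\<close>

lemma prime_dvd_card_finite_field:
  assumes "prime l" "l dvd CARD('a::{field,finite})"
  shows "l = CHAR('a)"
proof (rule ccontr)
  assume ne: "l \<noteq> CHAR('a)"
  define G where "G = \<lparr>carrier = (UNIV :: 'a set), monoid.mult = (+), one = (0 :: 'a)\<rparr>"
  have grp: "group G"
  proof (rule groupI)
    fix x assume "x \<in> carrier G"
    show "\<exists>y\<in>carrier G. y \<otimes>\<^bsub>G\<^esub> x = \<one>\<^bsub>G\<^esub>"
      by (intro bexI[of _ "-x"]) (auto simp: G_def)
  qed (auto simp: G_def add_ac)
  obtain m where m: "CARD('a) = l ^ 1 * m" using assms(2) by auto
  then obtain H where H: "subgroup H G" "card H = l"
    using sylow_thm[OF assms(1) grp, of 1 m] by (auto simp: G_def Coset.order_def)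
  have "card H > 1" using H(2) assms(1) prime_gt_1_nat by auto
  then obtain x where x: "x \<in> H" "x \<noteq> 0"
    using card_mono[of "{0 :: 'a}" H] by force
  have add: "y + z \<in> H" if "y \<in> H" "z \<in> H" for y z
    using subgroup.m_closed[OF H(1)] that by (simp add: G_def)
  \<comment> \<open>Translation by \<open>x\<close> permutes \<open>H\<close>; comparing the sums
    over \<open>H\<close> before and after gives \<open>card H\<close> times \<open>x\<close> equal
    to 0.\<close>
  have "(\<lambda>y. y + x) ` H = H"
    by (rule endo_inj_surj) (use add x in \<open>auto simp: inj_on_def\<close>)
  moreover have "sum id ((\<lambda>y. y + x) ` H) = (\<Sum>y\<in>H. y + x)"
    by (subst sum.reindex) (auto simp: inj_on_def)
  ultimately have "of_nat l * x = 0"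
    using H(2) by (simp add: sum.distrib)
  with x have "of_nat l = (0 :: 'a)" by simp
  then have "CHAR('a) dvd l" by (simp add: of_nat_eq_0_iff_char_dvd)
  with ne assms(1) prime_CHAR_finite_field[where 'a = 'a] show False
    using primes_dvd_imp_eq by blast
qed

lemma add_power_CHAR:
  fixes x y :: "'a::{field,finite}"
  shows "(x + y) ^ CHAR('a) = x ^ CHAR('a) + y ^ CHAR('a)"
proof -
  let ?p = "CHAR('a)"
  have p: "?p > 1" using prime_CHAR_finite_field prime_gt_1_nat by blast
  have "(x + y) ^ ?p = (\<Sum>k\<le>?p. of_nat (?p choose k) * x ^ k * y ^ (?p - k))"
    by (rule binomial_ring)
  also have "\<dots> = (\<Sum>k\<in>{0, ?p}. of_nat (?p choose k) * x ^ k * y ^ (?p - k))"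
  proof (rule sum.mono_neutral_right)
    have "of_nat (?p choose k) = (0 :: 'a)" if "k < ?p" "k \<noteq> 0" for k
      using dvd_choose_prime[OF that] prime_CHAR_finite_field p by (simp add: of_nat_eq_0_iff_char_dvd)
    then show "\<forall>k\<in>{..?p} - {0, ?p}. of_nat (?p choose k) * x ^ k * y ^ (?p - k) = 0"
      by auto
  qed auto
  finally show ?thesis using p by simp
qed

text \<open>Every prime divisor of \<open>q0\<close> divides the field order, hence is the
  characteristic. So \<open>q0\<close> is a power of the characteristic and \<open>x ^ q0\<close> an
  iterated Frobenius image.\<close>

lemma add_power_square_root_card:
  fixes x y :: "'a::{field,finite}"
  assumes "q0\<^sup>2 = CARD('a)"
  shows "(x + y) ^ q0 = x ^ q0 + y ^ q0"
proof -
  have "q0 > 0" using assms zero_less_card_finite[where 'a = 'a] by (cases q0) auto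
  moreover have "\<And>l. prime l \<Longrightarrow> l dvd q0 \<Longrightarrow> l = CHAR('a)"
    by (rule prime_dvd_card_finite_field) (simp_all add: assms[symmetric] power2_eq_square)
  ultimately have "\<exists>e. q0 = CHAR('a) ^ e"
  proof (induction q0 rule: less_induct)
    case (less n)
    show ?case
    proof (cases "n = 1")
      case False
      then obtain l where l: "prime l" "l dvd n" using prime_factor_nat by blast
      have "CHAR('a) dvd n" using less.prems(2)[OF l] l(2) by simp
      then obtain m where m: "n = CHAR('a) * m" by (rule dvdE)
      have "m < n" "m > 0"
        using m less.prems(1) prime_CHAR_finite_field[where 'a = 'a] prime_gt_1_nat[of "CHAR('a)"] by auto
      moreover have "\<And>l. prime l \<Longrightarrow> l dvd m \<Longrightarrow> l = CHAR('a)"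
        by (rule less.prems(2)) (simp_all add: m)
      ultimately obtain e where "m = CHAR('a) ^ e" using less.IH by blast
      then show ?thesis using m by (intro exI[of _ "Suc e"]) simp
    next
      case True
      then show ?thesis by (intro exI[of _ 0]) simp
    qed
  qed
  moreover have "(x + y) ^ (CHAR('a) ^ e) = x ^ (CHAR('a) ^ e) + y ^ (CHAR('a) ^ e)" for e
    by (induction e arbitrary: x y) (simp_all add: power_mult add_power_CHAR)
  ultimately show ?thesis by auto
qed

section \<open>The trace to the subfield of order \<open>q0\<close>\<close>

lemma card_power_eq_le:
  assumes "n > 1" "g \<noteq> (0 :: 'a::field poly) \<Longrightarrow> degree g < n"
  shows "card {x. x ^ n + poly g x = 0} \<le> n"
proof -
  let ?p = "monom 1 n + g"
  have "degree ?p = n" "?p \<noteq> 0"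
  proof -
    show d: "degree ?p = n"
      using assms by (cases "g = 0") (auto simp: degree_add_eq_left degree_monom_eq)
    then show "?p \<noteq> 0" using assms by auto
  qed
  then show ?thesis using card_poly_roots_bound[of ?p] by (simp add: poly_monom)
qed

text \<open>The trace \<open>x + x ^ q0\<close> is additive. Its image lies among the at most
  \<open>q0\<close> fixed elements of the power map and its kernel has at most \<open>q0\<close>
  elements, while the two sizes multiply to \<open>q0 * q0\<close>. Hence both are
  \<open>q0\<close>, every fixed element is a trace, and each fibre is a coset of the
  kernel.\<close>

lemma card_trace_fibre:
  fixes a b :: "'a::{field,finite}"
  assumes q0: "q0\<^sup>2 = CARD('a)" and "a \<noteq> 0" and b: "b ^ q0 = b"
  shows "card {c. b + (c * a + (c * a) ^ q0) = 0} = q0"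
proof -
  have q0_gt: "q0 > 1"
  proof -
    have "CARD('a) \<ge> card {0, 1 :: 'a}" by (intro card_mono) auto
    then have "1\<^sup>2 < q0\<^sup>2" using q0 by simp
    then show ?thesis by (rule power_less_imp_less_base) simp
  qed
  have pow: "(x ^ q0) ^ q0 = x" for x :: 'a
  proof -
    have "x ^ CARD('a) = x"
    proof (cases "x = 0")
      case False
      \<comment> \<open>Multiplication by \<open>x\<close> permutes the nonzero elements; comparing
        products gives \<open>x ^ (CARD('a) - 1) = 1\<close>.\<close>
      have "(\<Prod>y\<in>UNIV - {0}. x * y) = (\<Prod>y\<in>UNIV - {0}. y)"
        by (rule prod.reindex_bij_witness[of _ "\<lambda>y. y / x" "\<lambda>y. x * y"]) (use False in auto)
      then have "x ^ (CARD('a) - 1) = 1"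
        by (simp add: prod.distrib)
      moreover have "CARD('a) = Suc (CARD('a) - 1)" by simp
      ultimately show ?thesis by (metis power_Suc mult.right_neutral)
    qed simp
    then show ?thesis using q0 by (simp add: power_mult[symmetric] power2_eq_square)
  qed
  define tr where "tr x = x + x ^ q0" for x :: 'a
  define K where "K = {x. tr x = 0}"
  have add: "tr (x + y) = tr x + tr y" for x y
    by (simp add: tr_def add_power_square_root_card[OF q0])
  have diff: "tr x = tr y \<longleftrightarrow> tr (x - y) = 0" for x y
    using add[of "x - y" y] by auto
  have prod: "CARD('a) = card (range tr) * card K"
    by (rule card_additive_image) (auto simp: K_def diff[symmetric])
  have "range tr \<subseteq> {x. x ^ q0 = x}"
    by (auto simp: tr_def add_power_square_root_card[OF q0] pow)
  moreover have fix_le: "card {x :: 'a. x ^ q0 = x} \<le> q0"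
    using card_power_eq_le[of q0 "[:0, -1 :: 'a:]"] q0_gt by simp
  ultimately have im_le: "card (range tr) \<le> card {x :: 'a. x ^ q0 = x}"
    by (intro card_mono) auto
  have ker_le: "card K \<le> q0"
    using card_power_eq_le[of q0 "[:0, 1 :: 'a:]"] q0_gt by (simp add: K_def tr_def add.commute)
  have sq: "q0 * q0 = card (range tr) * card K" using prod q0 by (simp add: power2_eq_square)
  have K: "card K = q0"
  proof (rule ccontr)
    assume "card K \<noteq> q0"
    then have "q0 * card K < q0 * q0" using ker_le q0_gt by simp
    moreover have "card (range tr) * card K \<le> q0 * card K"
      using im_le fix_le by (intro mult_le_mono1) linarith
    ultimately show False using sq by linarith
  qed
  have "card (range tr) = q0" using sq K q0_gt by simp
  then have "card (range tr) = card {x :: 'a. x ^ q0 = x}" using im_le fix_le by simp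
  then have "range tr = {x. x ^ q0 = x}"
    using \<open>range tr \<subseteq> _\<close> by (intro card_subset_eq) auto
  moreover have "(- b) ^ q0 = - b"
    using add_power_square_root_card[OF q0, of b "- b"] b q0_gt by (simp add: eq_neg_iff_add_eq_0 add.commute power_0_left)
  ultimately obtain d where d: "tr d = - b" by (metis (mono_tags, lifting) mem_Collect_eq rangeE)
  \<comment> \<open>\<open>c\<close> solves the equation exactly when \<open>c * a\<close> has trace
    \<open>- b\<close>, that is, when \<open>c * a - d\<close> lies in the kernel.\<close>
  have "bij_betw (\<lambda>x. (x + d) / a) K {c. b + (c * a + (c * a) ^ q0) = 0}"
  proof (rule bij_betw_byWitness[where f' = "\<lambda>c. c * a - d"])
    show "(\<lambda>x. (x + d) / a) ` K \<subseteq> {c. b + (c * a + (c * a) ^ q0) = 0}"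
      using assms(2) add d by (auto simp: K_def tr_def[symmetric])
    show "(\<lambda>c. c * a - d) ` {c. b + (c * a + (c * a) ^ q0) = 0} \<subseteq> K"
      using d by (auto simp: K_def tr_def[symmetric] diff[symmetric] add_eq_0_iff)
  qed (use assms(2) in auto)
  then show ?thesis using K by (simp add: bij_betw_same_card[symmetric])
qed

section \<open>Counting subspaces\<close>

lemma card_finite_field_ge_2: "CARD('a::{field,finite}) \<ge> 2"
  using card_mono[of UNIV "{0, 1 :: 'a}"] by simp

locale finite_field_space = finite_dimensional_vector_space scale Basis
  for scale :: "'a::{field,finite} \<Rightarrow> 'v::ab_group_add \<Rightarrow> 'v"  (infixr \<open>*s\<close> 75)
    and Basis :: "'v set" +
  fixes q :: nat
  assumes q_eq: "q = CARD('a)"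
begin

lemma q_ge_2: "q \<ge> 2"
  unfolding q_eq by (rule card_finite_field_ge_2)

text \<open>A vector of the enlarged span is uniquely \<open>c *s b + w\<close>, so each basis
  vector multiplies the size by \<open>q\<close>. Finiteness is carried along because finiteness of
  the whole space is derived from this lemma.\<close>

lemma finite_card_span_independent:
  assumes "finite B" "independent B"
  shows "finite (span B) \<and> card (span B) = q ^ card B"
  using assms
proof (induction B)
  case (insert b B)
  then have b: "b \<notin> span B" and ind: "independent B"
    using independent_insert by auto
  have bij: "bij_betw (\<lambda>(c, w). c *s b + w) (UNIV \<times> span B) (span (insert b B))"
    unfolding bij_betw_def
  proof
    show "inj_on (\<lambda>(c, w). c *s b + w) (UNIV \<times> span B)"
    proof (intro inj_onI, clarify)
      fix c w c' w' assume w: "w \<in> span B" "w' \<in> span B" and eq: "c *s b + w = c' *s b + w'"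
      then have *: "(c - c') *s b \<in> span B"
      proof -
        have "(c - c') *s b = w' - w" using eq by (simp add: scale_left_diff_distrib algebra_simps)
        then show ?thesis using span_diff[OF w(2) w(1)] by simp
      qed
      have "c = c'"
      proof (rule ccontr)
        assume "c \<noteq> c'"
        then have "b \<in> span B"
          using span_scale[OF *, of "inverse (c - c')"] by simp
        with b show False by simp
      qed
      with eq show "c = c' \<and> w = w'" by simp
    qed
    show "(\<lambda>(c, w). c *s b + w) ` (UNIV \<times> span B) = span (insert b B)"
    proof (intro equalityI subsetI)
      fix x assume "x \<in> (\<lambda>(c, w). c *s b + w) ` (UNIV \<times> span B)"
      then obtain c w where "x = c *s b + w" "w \<in> span (insert b B)"
        using span_mono[of B "insert b B"] by auto
      then show "x \<in> span (insert b B)" by (simp add: span_add span_scale span_base)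
    next
      fix x assume "x \<in> span (insert b B)"
      then obtain c where "x - c *s b \<in> span B" using span_breakdown_eq by auto
      then show "x \<in> (\<lambda>(c, w). c *s b + w) ` (UNIV \<times> span B)"
        by (intro image_eqI[of _ _ "(c, x - c *s b)"]) auto
    qed
  qed
  show ?case
    using bij_betw_finite[OF bij] bij_betw_same_card[OF bij] insert.IH[OF ind] insert.hyps
    by (simp add: card_cartesian_product q_eq finite_cartesian_product_iff)
qed simp

lemma finite_space [simp]: "finite (A :: 'v set)"
proof -
  have "finite (span Basis)"
    using finite_card_span_independent[OF finite_Basis independent_Basis] by simp
  then show ?thesis by (rule finite_subset[rotated]) (simp add: span_Basis)
qed

lemma card_subspace:
  assumes "subspace W"
  shows "card W = q ^ dim W"
proof -
  obtain B where B: "B \<subseteq> W" "independent B" "W \<subseteq> span B" "card B = dim W"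
    by (rule basis_exists)
  have "span B = W" using span_minimal[OF B(1) assms] B(3) by (rule antisym)
  then show ?thesis
    using finite_card_span_independent[OF finite_space B(2)] B(4) by simp
qed

section \<open>Counting subspaces through one-vector extensions\<close>

lemma dim_span_insert:
  assumes "subspace J" "v \<notin> J"
  shows "dim (span (insert v J)) = Suc (dim J)"
proof -
  have "span J = J" using assms by (simp only: span_eq_iff)
  then show ?thesis using assms by (simp add: dim_insert del: span_eq_iff)
qed

lemma span_insert_subset_iff:
  assumes "subspace W"
  shows "span (insert v J) \<subseteq> W \<longleftrightarrow> v \<in> W \<and> J \<subseteq> W"
proof
  assume "span (insert v J) \<subseteq> W"
  then have "insert v J \<subseteq> W" using span_superset by (rule subset_trans[rotated])
  then show "v \<in> W \<and> J \<subseteq> W" by simp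
qed (simp add: span_minimal assms)

text \<open>Pairs \<open>(v, X)\<close> with \<open>v \<in> X - J\<close> are counted twice: each
  \<open>X\<close> admits \<open>q ^ t - q ^ dim J\<close> vectors, and each \<open>v\<close> admits
  \<open>F (Suc (dim J))\<close> spaces by induction on \<open>t - dim J\<close>. The family is an
  arbitrary downward closed one, to cover both the subspaces of a fixed space and the isotropic
  subspaces.\<close>

lemma card_extensions:
  fixes F c :: "nat \<Rightarrow> real"
  assumes sub: "\<And>X. X \<in> \<P> \<Longrightarrow> subspace X"
    and down: "\<And>X Y. X \<in> \<P> \<Longrightarrow> subspace Y \<Longrightarrow> Y \<subseteq> X \<Longrightarrow> Y \<in> \<P>"
    and c: "\<And>J. J \<in> \<P> \<Longrightarrow> dim J < t \<Longrightarrow> real (card {v. v \<notin> J \<and> span (insert v J) \<in> \<P>}) = c (dim J)"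
    and F: "F t = 1" "\<And>j. j < t \<Longrightarrow> F j * (real q ^ t - real q ^ j) = c j * F (Suc j)"
    and "J \<in> \<P>" "dim J \<le> t"
  shows "real (card {X \<in> \<P>. J \<subseteq> X \<and> dim X = t}) = F (dim J)"
  using assms(6,7)
proof (induction "t - dim J" arbitrary: J)
  case 0
  then have dim: "dim J = t" by simp
  have "{X \<in> \<P>. J \<subseteq> X \<and> dim X = t} = {J}"
  proof (intro equalityI subsetI)
    fix X assume "X \<in> {X \<in> \<P>. J \<subseteq> X \<and> dim X = t}"
    then show "X \<in> {J}"
      using subspace_dim_equal[of J X] sub 0 dim by auto
  qed (use 0 dim in auto)
  then show ?case using F(1) dim by simp
next
  case (Suc d)
  then have less: "dim J < t" by simp
  let ?X = "{X \<in> \<P>. J \<subseteq> X \<and> dim X = t}"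
  let ?E = "{v. v \<notin> J \<and> span (insert v J) \<in> \<P>}"
  have fin: "finite ?X" by (rule finite_subset[of _ UNIV]) (simp_all add: Finite_Set.finite_set)
  have "(\<Sum>X\<in>?X. \<Sum>v\<in>{v. v \<in> ?E \<and> v \<in> X}. 1 :: real) = (\<Sum>X\<in>?X. real q ^ t - real q ^ dim J)"
  proof (intro sum.cong refl)
    fix X assume X: "X \<in> ?X"
    \<comment> \<open>Downward closure makes every vector of \<open>X - J\<close> an admissible
      extension of \<open>J\<close>.\<close>
    then have "{v. v \<in> ?E \<and> v \<in> X} = X - J"
      using sub down[of X "span (insert v J)" for v] by (auto simp: span_insert_subset_iff)
    moreover have "card (X - J) = card X - card J" "card J \<le> card X"
      using X by (auto intro: card_Diff_subset card_mono)
    ultimately show "(\<Sum>v\<in>{v. v \<in> ?E \<and> v \<in> X}. 1 :: real) = real q ^ t - real q ^ dim J"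
      using X sub Suc.prems by (simp add: card_subspace of_nat_diff)
  qed
  moreover have "(\<Sum>X\<in>?X. \<Sum>v\<in>{v. v \<in> ?E \<and> v \<in> X}. 1 :: real)
      = (\<Sum>v\<in>?E. \<Sum>X\<in>{X. X \<in> ?X \<and> v \<in> X}. 1)"
    by (rule sum.swap_restrict) (use fin in auto)
  moreover have "\<dots> = (\<Sum>v\<in>?E. F (Suc (dim J)))"
  proof (intro sum.cong refl)
    fix v assume v: "v \<in> ?E"
    have J: "subspace J" using sub Suc.prems by auto
    have d: "dim (span (insert v J)) = Suc (dim J)" using v by (intro dim_span_insert J) auto
    have "{X. X \<in> ?X \<and> v \<in> X} = {X \<in> \<P>. span (insert v J) \<subseteq> X \<and> dim X = t}"
      using sub by (intro Collect_cong) (simp add: span_insert_subset_iff cong: conj_cong, blast)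
    then show "(\<Sum>X\<in>{X. X \<in> ?X \<and> v \<in> X}. 1 :: real) = F (Suc (dim J))"
      using Suc.hyps(1)[of "span (insert v J)"] Suc.hyps(2) v d less by simp
  qed
  ultimately have "real (card ?X) * (real q ^ t - real q ^ dim J) = c (dim J) * F (Suc (dim J))"
    using c[OF Suc.prems(1) less] by simp
  then have "real (card ?X) * (real q ^ t - real q ^ dim J) = F (dim J) * (real q ^ t - real q ^ dim J)"
    using F(2)[OF less] by simp
  moreover have "real q ^ dim J < real q ^ t"
    using less q_ge_2 by (intro power_strict_increasing) auto
  then have "real q ^ t - real q ^ dim J \<noteq> 0" by simp
  ultimately show ?case by (rule mult_right_cancel[THEN iffD1, rotated])
qed

text \<open>In the family of subspaces of \<open>W\<close>, a \<open>j\<close>-dimensional member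
  has \<open>q ^ dim W - q ^ j\<close> extending vectors, and the Gaussian binomials solve the
  resulting recurrence. For \<open>t > dim W\<close> both sides are zero.\<close>

lemma card_subspaces_between:
  assumes "subspace J" "subspace W" "J \<subseteq> W" "dim J \<le> t"
  shows "real (card {X. subspace X \<and> J \<subseteq> X \<and> X \<subseteq> W \<and> dim X = t})
       = gauss_binomial q (dim W - dim J) (t - dim J)"
proof (cases "t \<le> dim W")
  case True
  have "real (card {X \<in> {X. subspace X \<and> X \<subseteq> W}. J \<subseteq> X \<and> dim X = t})
      = gauss_binomial q (dim W - dim J) (t - dim J)"
  proof (rule card_extensions[where c = "\<lambda>j. real q ^ dim W - real q ^ j"])
    fix J assume J: "J \<in> {X. subspace X \<and> X \<subseteq> W}"
    then have "{v. v \<notin> J \<and> span (insert v J) \<in> {X. subspace X \<and> X \<subseteq> W}} = W - J"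
      using assms(2) by (auto simp: span_insert_subset_iff)
    moreover have "card (W - J) = card W - card J" "card J \<le> card W"
      using J by (auto intro: card_Diff_subset card_mono)
    ultimately show "real (card {v. v \<notin> J \<and> span (insert v J) \<in> {X. subspace X \<and> X \<subseteq> W}})
        = real q ^ dim W - real q ^ dim J"
      using J assms(2) by (simp add: card_subspace of_nat_diff)
  next
    fix j assume j: "j < t"
    define m k where "m = dim W - Suc j" and "k = t - Suc j"
    have e: "dim W - j = Suc m" "t - j = Suc k" "dim W - Suc j = m" "t - Suc j = k"
      "real q ^ t = real q ^ j * real q ^ Suc k" "real q ^ dim W = real q ^ j * real q ^ Suc m"
      using j True by (simp_all add: m_def k_def flip: power_add power_Suc)
    show "gauss_binomial q (dim W - j) (t - j) * (real q ^ t - real q ^ j)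
       = (real q ^ dim W - real q ^ j) * gauss_binomial q (dim W - Suc j) (t - Suc j)"
    proof -
      have "gauss_binomial q (Suc m) (Suc k) * (real q ^ j * real q ^ Suc k - real q ^ j)
          = real q ^ j * (gauss_binomial q (Suc m) (Suc k) * (real q ^ Suc k - 1))"
        by (simp add: algebra_simps)
      also have "\<dots> = (real q ^ j * real q ^ Suc m - real q ^ j) * gauss_binomial q m k"
        unfolding gauss_binomial_Suc_Suc[OF q_ge_2] by (simp add: algebra_simps)
      finally show ?thesis unfolding e .
    qed
  qed (use assms in auto)
  then show ?thesis by (simp add: conj_ac del: span_eq_iff)
next
  case False
  then have none: "{X. subspace X \<and> J \<subseteq> X \<and> X \<subseteq> W \<and> dim X = t} = {}"
    using dim_subset by fastforce
  have "dim W - dim J < t - dim J" using False assms dim_subset[OF assms(3)] by linarith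
  with none show ?thesis by (simp only: card.empty gauss_binomial_eq_0 of_nat_0)
qed

end

section \<open>Isotropic subspaces\<close>

text \<open>The common properties of the three kinds of forms. Singularity is separate from
  \<open>f x x = 0\<close> because for a quadratic form \<open>f\<close> is its polar form.
  Nondegeneracy is asked of singular vectors only, since a polar form may be degenerate in
  characteristic 2. The number \<open>e\<close> is the only quantity that depends on the kind of
  form.\<close>

locale isotropy_space = finite_field_space scale Basis q
  for scale :: "'a::{field,finite} \<Rightarrow> 'v::ab_group_add \<Rightarrow> 'v"  (infixr \<open>*s\<close> 75)
    and Basis :: "'v set" and q :: nat +
  fixes f :: "'v \<Rightarrow> 'v \<Rightarrow> 'a" and sing :: "'v \<Rightarrow> bool" and e :: nat
  assumes f_add_left: "f (x + y) z = f x z + f y z"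
    and f_scale_left: "f (c *s x) z = c * f x z"
    and f_add_right: "f x (y + z) = f x y + f x z"
    and f_sym: "f x y = 0 \<longleftrightarrow> f y x = 0"
    and f_sing: "sing x \<Longrightarrow> f x x = 0"
    and sing_0: "sing 0"
    and sing_scale: "sing x \<Longrightarrow> sing (c *s x)"
    and sing_add: "sing x \<Longrightarrow> sing y \<Longrightarrow> f x y = 0 \<Longrightarrow> sing (x + y)"
    and nondegenerate_sing: "sing x \<Longrightarrow> (\<And>v. f v x = 0) \<Longrightarrow> x = 0"
    and card_sing_line: "sing x \<Longrightarrow> f v x \<noteq> 0 \<Longrightarrow> card {c. sing (v + c *s x)} = e"
begin

definition isotropic :: "'v set set" where
  "isotropic = {U. subspace U \<and> (\<forall>x\<in>U. sing x) \<and> (\<forall>x\<in>U. \<forall>y\<in>U. f x y = 0)}"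

definition perp :: "'v set \<Rightarrow> 'v set" where
  "perp J = {v. \<forall>y\<in>J. f v y = 0}"

definition sing_perp :: "'v set \<Rightarrow> 'v set" where
  "sing_perp J = {v \<in> perp J. sing v}"

lemma f_zero_left [simp]: "f 0 z = 0"
  using f_scale_left[of 0 0 z] by simp

lemma f_zero_right [simp]: "f z 0 = 0"
  using f_sym by simp

lemma f_diff_left: "f (x - y) z = f x z - f y z"
  using f_add_left[of "x - y" y z] by simp

lemma f_diff_right: "f x (y - z) = f x y - f x z"
  using f_add_right[of x "y - z" z] by simp

lemma f_scale_right: "f x y = 0 \<Longrightarrow> f x (c *s y) = 0"
  by (subst (asm) f_sym, subst f_sym) (simp add: f_scale_left)

lemma isotropic_subspace: "J \<in> isotropic \<Longrightarrow> subspace J"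
  by (simp add: isotropic_def)

lemma isotropic_mono: "J \<in> isotropic \<Longrightarrow> subspace K \<Longrightarrow> K \<subseteq> J \<Longrightarrow> K \<in> isotropic"
  by (auto simp: isotropic_def)

lemma isotropic_0: "{0} \<in> isotropic"
  by (simp add: isotropic_def sing_0 subspace_single_0)

section \<open>Orthogonal spaces and their singular vectors\<close>

lemma subspace_perp: "subspace (perp J)"
  by (rule subspaceI) (auto simp: perp_def f_add_left f_scale_left)

lemma subspace_right_zeros: "subspace {y. \<forall>v\<in>A. f v y = 0}"
  by (rule subspaceI) (auto simp: f_add_right f_scale_right)

lemma subspace_left_zeros: "subspace {v. f v y = 0}"
  by (rule subspaceI) (auto simp: f_add_left f_scale_left)

lemma perp_span: "perp (span B) = perp B"
proof -
  have "span B \<subseteq> {y. \<forall>v\<in>perp B. f v y = 0}"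
    by (rule span_minimal[OF _ subspace_right_zeros]) (auto simp: perp_def)
  then show ?thesis using span_superset[of B] by (fastforce simp: perp_def)
qed

lemma perp_insert: "perp (insert x J) = {v \<in> perp J. f v x = 0}"
  by (auto simp: perp_def)

text \<open>Upper bound: extend a basis \<open>B\<close> of \<open>perp J\<close> to a basis
  \<open>C\<close> of the space; an element \<open>y\<close> of \<open>J\<close> is determined by
  the values \<open>f c y\<close> for \<open>c \<in> C - B\<close>, since those on \<open>B\<close>
  vanish. Lower bound: evaluation on a basis of \<open>J\<close> has kernel \<open>perp J\<close>
  and at most \<open>q ^ dim J\<close> values.\<close>

lemma card_perp:
  assumes J: "J \<in> isotropic"
  shows "card (perp J) * q ^ dim J = q ^ dim (UNIV :: 'v set)"
proof (rule antisym)
  obtain B where B: "B \<subseteq> perp J" "independent B" "perp J \<subseteq> span B" "card B = dim (perp J)"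
    by (rule basis_exists)
  obtain C where C: "B \<subseteq> C" "independent C" "UNIV \<subseteq> span C"
    using maximal_independent_subset_extend[of B UNIV] B(2) by auto
  have card_C: "card C = dim (UNIV :: 'v set)"
    using basis_card_eq_dim[of C UNIV] C by simp
  define h where "h y = restrict (\<lambda>c. f c y) (C - B)" for y
  have "inj_on h J"
  proof (rule inj_onI)
    fix y z assume yz: "y \<in> J" "z \<in> J" "h y = h z"
    have "f c (y - z) = 0" if "c \<in> C" for c
    proof (cases "c \<in> B")
      case True
      then show ?thesis using B(1) yz by (auto simp: perp_def f_diff_right)
    next
      case False
      then show ?thesis using fun_cong[OF yz(3), of c] that by (simp add: h_def f_diff_right)
    qed
    \<comment> \<open>The difference is orthogonal to the whole space and, lying in
      \<open>J\<close>, is singular, so nondegeneracy on singular vectors makes it zero.\<close>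
    then have "span C \<subseteq> {v. f v (y - z) = 0}"
      by (intro span_minimal subspace_left_zeros) auto
    moreover have "y - z \<in> J" using yz J isotropic_subspace subspace_diff by blast
    ultimately have "y - z = 0"
      using C(3) J by (intro nondegenerate_sing) (auto simp: isotropic_def)
    then show "y = z" by simp
  qed
  moreover have "h ` J \<subseteq> (C - B) \<rightarrow>\<^sub>E UNIV" by (simp add: h_def image_subset_iff)
  ultimately have "card J \<le> card ((C - B) \<rightarrow>\<^sub>E (UNIV :: 'a set))"
    by (intro card_inj_on_le[of h]) (auto intro: finite_PiE)
  also have "\<dots> = q ^ (card C - card B)"
    using C(1) by (simp add: card_PiE q_eq card_Diff_subset)
  finally have "q ^ dim J \<le> q ^ (card C - card B)"
    using J isotropic_subspace card_subspace by simp
  then have "card (perp J) * q ^ dim J \<le> q ^ dim (perp J) * q ^ (card C - card B)"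
    by (simp add: card_subspace[OF subspace_perp])
  also have "\<dots> = q ^ dim (UNIV :: 'v set)"
    using B(4) card_C card_mono[OF finite_space C(1)] by (simp flip: power_add)
  finally show "card (perp J) * q ^ dim J \<le> q ^ dim (UNIV :: 'v set)" .
next
  obtain B where B: "B \<subseteq> J" "independent B" "J \<subseteq> span B" "card B = dim J"
    by (rule basis_exists)
  have span_B: "span B = J"
    using B isotropic_subspace[OF J] span_minimal by blast
  define h where "h v = restrict (f v) B" for v
  have "card (UNIV :: 'v set) = card (range h) * card (perp J)"
  proof (rule card_additive_image)
    fix x y
    have "h x = h y \<longleftrightarrow> (\<forall>b\<in>B. f x b = f y b)"
      unfolding h_def by (metis restrict_apply' restrict_ext)
    also have "\<dots> \<longleftrightarrow> x - y \<in> perp B"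
      by (auto simp: perp_def f_diff_left)
    finally show "h x = h y \<longleftrightarrow> x - y \<in> perp J"
      using perp_span[of B] span_B by simp
  qed auto
  moreover have "card (range h) \<le> card (B \<rightarrow>\<^sub>E (UNIV :: 'a set))"
    by (intro card_mono finite_PiE) (simp_all add: h_def image_subset_iff)
  moreover have "card (B \<rightarrow>\<^sub>E (UNIV :: 'a set)) = q ^ dim J"
    using B(4) by (simp add: card_PiE q_eq)
  ultimately show "q ^ dim (UNIV :: 'v set) \<le> card (perp J) * q ^ dim J"
    unfolding card_subspace[OF subspace_UNIV, symmetric] by (simp add: mult.commute)
qed

lemma isotropic_subset_sing_perp: "J \<in> isotropic \<Longrightarrow> J \<subseteq> sing_perp J"
  by (auto simp: isotropic_def sing_perp_def perp_def)

text \<open>Vectors of the enlarged span have the form \<open>c *s v + y\<close> with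
  \<open>y \<in> J\<close>, and singularity passes to multiples and orthogonal sums. Counting
  extensions of \<open>J\<close> thus becomes counting singular vectors in
  \<open>perp J\<close>.\<close>

lemma isotropic_insert_iff:
  assumes J: "J \<in> isotropic"
  shows "span (insert v J) \<in> isotropic \<longleftrightarrow> v \<in> sing_perp J"
proof
  assume "span (insert v J) \<in> isotropic"
  then show "v \<in> sing_perp J"
    using span_base[of _ "insert v J"] by (auto simp: isotropic_def sing_perp_def perp_def)
next
  assume v: "v \<in> sing_perp J"
  have sub: "subspace J" using J isotropic_subspace by auto
  have decomp: "\<exists>c y. y \<in> J \<and> x = c *s v + y" if x: "x \<in> span (insert v J)" for x
  proof -
    obtain c where "x - c *s v \<in> span J" using x span_breakdown_eq by auto
    then show ?thesis using sub by (intro exI[of _ c] exI[of _ "x - c *s v"]) (simp add: span_eq_iff[THEN iffD2])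
  qed
  have vJ: "f v y = 0" "f y v = 0" if "y \<in> J" for y
    using v that f_sym by (auto simp: sing_perp_def perp_def)
  have vv: "f v v = 0" "sing v" using v f_sing by (auto simp: sing_perp_def)
  have JJ: "f y z = 0" "sing y" if "y \<in> J" "z \<in> J" for y z
    using J that by (auto simp: isotropic_def)
  have "sing x" if "x \<in> span (insert v J)" for x
    using decomp[OF that] vJ vv JJ by (auto intro!: sing_add sing_scale simp: f_scale_left)
  moreover have "f x y = 0" if "x \<in> span (insert v J)" "y \<in> span (insert v J)" for x y
    using decomp[OF that(1)] decomp[OF that(2)] vJ vv JJ
    by (auto simp: f_add_left f_add_right f_scale_left f_scale_right)
  ultimately show "span (insert v J) \<in> isotropic"
    by (simp add: isotropic_def)
qed

text \<open>Every line through \<open>v\<close> in direction \<open>x\<close>, with \<open>v\<close> not orthogonal to \<open>x\<close>, carries exactly \<open>e\<close>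
  singular vectors, so a fraction \<open>e / q\<close> of the vectors in \<open>perp J\<close> that are lost when \<open>J\<close> is
  enlarged by \<open>x\<close> is singular.\<close>

lemma sing_perp_insert:
  assumes J: "J \<in> isotropic" and x: "x \<in> sing_perp J"
  shows "real (card (sing_perp (span (insert x J)))) - real e / real q * real (card (perp (span (insert x J))))
       = real (card (sing_perp J)) - real e / real q * real (card (perp J))"
proof -
  define A where "A = {v \<in> perp J. f v x \<noteq> 0}"
  have sx: "sing x" "f x x = 0" using x f_sing by (auto simp: sing_perp_def)
  \<comment> \<open>Moving along \<open>x\<close> stays inside \<open>A\<close>, because
    \<open>x\<close> is orthogonal to \<open>J\<close> and to itself. So counting pairs
    \<open>(v, c)\<close> by \<open>c\<close> gives the same number for every
    \<open>c\<close>.\<close>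
  have shift: "bij_betw (\<lambda>v. v + c *s x) {v \<in> A. sing (v + c *s x)} {v \<in> A. sing v}" for c
    by (rule bij_betw_byWitness[where f' = "\<lambda>v. v - c *s x"])
      (use x sx in \<open>auto simp: A_def sing_perp_def perp_def f_add_left f_diff_left f_scale_left\<close>)
  have "(\<Sum>v\<in>A. \<Sum>c\<in>{c. c \<in> UNIV \<and> sing (v + c *s x)}. 1) = (\<Sum>c\<in>UNIV. \<Sum>v\<in>{v. v \<in> A \<and> sing (v + c *s x)}. (1 :: nat))"
    by (rule sum.swap_restrict) auto
  moreover have "(\<Sum>v\<in>A. \<Sum>c\<in>{c. c \<in> UNIV \<and> sing (v + c *s x)}. 1) = (\<Sum>v\<in>A. e)"
    using card_sing_line[OF sx(1)] by (intro sum.cong) (auto simp: A_def)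
  moreover have "(\<Sum>c\<in>UNIV. \<Sum>v\<in>{v. v \<in> A \<and> sing (v + c *s x)}. (1 :: nat)) = (\<Sum>c\<in>(UNIV :: 'a set). card {v \<in> A. sing v})"
    by (intro sum.cong refl) (simp add: bij_betw_same_card[OF shift])
  ultimately have count: "card A * e = q * card {v \<in> A. sing v}"
    by (simp add: q_eq)
  have "perp J = perp (span (insert x J)) \<union> A" "perp (span (insert x J)) \<inter> A = {}"
    and "sing_perp J = sing_perp (span (insert x J)) \<union> {v \<in> A. sing v}"
      "sing_perp (span (insert x J)) \<inter> {v \<in> A. sing v} = {}"
    by (auto simp: perp_span perp_insert A_def sing_perp_def)
  then have "card (perp J) = card (perp (span (insert x J))) + card A"
    and "card (sing_perp J) = card (sing_perp (span (insert x J))) + card {v \<in> A. sing v}"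
    by (metis card_Un_disjoint finite_space)+
  moreover have "real (card {v \<in> A. sing v}) = real e / real q * real (card A)"
    using arg_cong[OF count, of real] q_ge_2 by (simp add: field_simps)
  ultimately show ?thesis by (simp add: algebra_simps)
qed

text \<open>Adjoining one vector leaves the difference unchanged, so building up the space from
  \<open>{0}\<close> does too. The form with \<open>span B\<close> permits induction on the finite
  set \<open>B\<close>.\<close>

lemma sing_perp_const:
  assumes "span B \<in> isotropic"
  shows "real (card (sing_perp (span B))) - real e / real q * real (card (perp (span B)))
       = real (card (sing_perp {0})) - real e / real q * real (card (perp {0}))"
proof -
  have "finite B" by simp
  then show ?thesis using assms
  proof (induction B)
    case (insert b B)
    have sp: "span (insert b B) = span (insert b (span B))"
      using span_insert[of b B] span_insert[of b "span B"] by (simp only: span_span)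
    have iso: "span B \<in> isotropic"
      using insert.prems isotropic_mono[of "span (insert b B)" "span B"] span_mono[of B "insert b B"] by auto
    then have "b \<in> sing_perp (span B)"
      using insert.prems isotropic_insert_iff sp by simp
    then show ?case
      using sing_perp_insert[OF iso] insert.IH[OF iso] sp by simp
  qed simp
qed

text \<open>An isotropic \<open>U\<close> of dimension \<open>r\<close> satisfies
  \<open>sing_perp U = U\<close>, which evaluates the constant of \<open>sing_perp_const\<close>.
  This gives the size of \<open>sing_perp J\<close>, from which the vectors of \<open>J\<close> are
  removed.\<close>

lemma card_isotropic_extensions:
  assumes r: "r = Max (dim ` isotropic)" and J: "J \<in> isotropic"
  shows "real (card {v. v \<notin> J \<and> span (insert v J) \<in> isotropic})
     = real q ^ r + real e / real q * real q ^ dim (UNIV :: 'v set) * (1 / real q ^ dim J - 1 / real q ^ r) - real q ^ dim J"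
proof -
  have fin: "finite isotropic" by (rule finite_subset[of _ UNIV]) (simp_all add: Finite_Set.finite_set)
  have "r \<in> dim ` isotropic"
    unfolding r using fin isotropic_0 by (intro Max_in) auto
  then obtain U where U: "U \<in> isotropic" "dim U = r" by auto
  have "v \<in> U" if v: "v \<in> sing_perp U" for v
  proof (rule ccontr)
    assume "v \<notin> U"
    then have "dim (span (insert v U)) = Suc r"
      using dim_span_insert[OF isotropic_subspace[OF U(1)]] U(2) by simp
    moreover have "dim (span (insert v U)) \<le> r"
      unfolding r using fin U(1) v by (intro Max_ge) (auto simp: isotropic_insert_iff simp del: dim_span)
    ultimately show False by simp
  qed
  then have "sing_perp U = U" using isotropic_subset_sing_perp U by blast
  then have cU: "card (sing_perp U) = q ^ r" using U isotropic_subspace card_subspace by simp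
  have perp: "real (card (perp K)) = real q ^ dim (UNIV :: 'v set) / real q ^ dim K" if "K \<in> isotropic" for K
    using arg_cong[OF card_perp[OF that], of real] q_ge_2 by (simp add: field_simps)
  have const: "real (card (sing_perp K)) - real e / real q * real (card (perp K))
      = real (card (sing_perp {0})) - real e / real q * real (card (perp {0}))" if "K \<in> isotropic" for K
    using sing_perp_const[of K] that isotropic_subspace[OF that] by (simp add: span_eq_iff[THEN iffD2])
  have "{v. v \<notin> J \<and> span (insert v J) \<in> isotropic} = sing_perp J - J"
    using J by (auto simp: isotropic_insert_iff)
  moreover have "card (sing_perp J - J) = card (sing_perp J) - card J" "card J \<le> card (sing_perp J)"
    using isotropic_subset_sing_perp[OF J] by (auto intro: card_Diff_subset card_mono)
  moreover have "card J = q ^ dim J" using J isotropic_subspace card_subspace by simp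
  ultimately have "real (card {v. v \<notin> J \<and> span (insert v J) \<in> isotropic}) = real (card (sing_perp J)) - real q ^ dim J"
    by (simp add: of_nat_diff)
  then show ?thesis
    using const[OF J] const[OF U(1)] perp[OF J] perp[OF U(1)] U(2) cU by (simp add: algebra_simps)
qed

text \<open>Under the hypothesis on \<open>e\<close>, a \<open>j\<close>-dimensional member has
  \<open>q ^ j * (q ^ (r - j) - 1) * (w + 1)\<close> extending vectors, with \<open>w\<close> the
  power of \<open>q\<close> of exponent \<open>r - j + \<epsilon>\<close>. The factor
  \<open>w + 1\<close> is the top factor of the product in \<open>polar_binomial\<close>.\<close>

lemma card_isotropic_above:
  assumes r: "r = Max (dim ` isotropic)"
    and e: "real e / real q * real q ^ dim (UNIV :: 'v set) = real q powr (2 * real r + epsilon Q)"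
    and J: "J \<in> isotropic" "dim J \<le> t" and "t \<le> r"
  shows "real (card {X \<in> isotropic. J \<subseteq> X \<and> dim X = t}) = polar_binomial q Q (r - dim J) (t - dim J)"
proof (rule card_extensions[OF isotropic_subspace isotropic_mono card_isotropic_extensions[OF r]])
  fix j assume j: "j < t"
  define a b where "a = r - Suc j" and "b = t - Suc j"
  have ab: "r - j = Suc a" "t - j = Suc b" "b \<le> a" "r = j + Suc a" "t = j + Suc b"
    using j assms(5) by (auto simp: a_def b_def)
  have q0: "real q > 0" using q_ge_2 by simp
  let ?w = "real q powr (real (Suc a) + epsilon Q)"
  have interval: "{Suc a - Suc b + 1..Suc a} = insert (Suc a) {a - b + 1..a}" using ab(3) by auto
  have pb: "polar_binomial q Q (Suc a) (Suc b) = gauss_binomial q (Suc a) (Suc b) * (?w + 1)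
      * (\<Prod>i = a - b + 1..a. real q powr (real i + epsilon Q) + 1)"
    unfolding polar_binomial_def interval by (subst prod.insert) auto
  have "real q powr (2 * real r + epsilon Q) = real q powr (real (j + Suc a)) * real q powr real j * ?w"
    unfolding powr_add[symmetric] by (simp add: ab(4) algebra_simps)
  also have "\<dots> = real q ^ (j + Suc a) * real q ^ j * ?w"
    using q0 by (simp only: powr_realpow)
  finally have E: "real e / real q * real q ^ dim (UNIV :: 'v set) = real q ^ (j + Suc a) * real q ^ j * ?w"
    using e by simp
  \<comment> \<open>By \<open>E\<close> the middle term is \<open>?w * (q ^ r - q ^ j)\<close>, so
    \<open>q ^ r - q ^ j\<close> factors out.\<close>
  have "real q ^ r + real e / real q * real q ^ dim (UNIV :: 'v set) * (1 / real q ^ j - 1 / real q ^ r) - real q ^ j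
      = real q ^ j * (real q ^ Suc a - 1) * (?w + 1)"
    unfolding E unfolding ab(4) using q0 by (simp add: field_simps power_add)
  moreover have "(real q ^ t - real q ^ j) = real q ^ j * (real q ^ Suc b - 1)"
    by (simp add: ab(5) power_add algebra_simps)
  ultimately show "polar_binomial q Q (r - j) (t - j) * (real q ^ t - real q ^ j)
      = (real q ^ r + real e / real q * real q ^ dim (UNIV :: 'v set) * (1 / real q ^ j - 1 / real q ^ r) - real q ^ j)
        * polar_binomial q Q (r - Suc j) (t - Suc j)"
    using gauss_binomial_Suc_Suc[OF q_ge_2, of a b]
    by (simp only: ab(1,2) pb a_def[symmetric] b_def[symmetric])
      (simp add: polar_binomial_def del: power_Suc)
qed (use J in \<open>auto simp: polar_binomial_def\<close>)

end

section \<open>Polar spaces and designs\<close>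

context finite_field_space
begin

section \<open>The three kinds of forms as isotropy spaces\<close>

lemma bilinear_formD:
  assumes "bilinear_form f"
  shows "f (x + y) z = f x z + f y z" "f (c *s x) z = c * f x z"
    and "f x (y + z) = f x y + f x z" "f x (c *s y) = c * f x y"
proof -
  have 1: "module_hom scale (*) (\<lambda>x. f x z)" and 2: "module_hom scale (*) (f x)" for x z
    using assms unfolding bilinear_form_def by (auto dest: Vector_Spaces.linear.axioms)
  show "f (x + y) z = f x z + f y z" "f (c *s x) z = c * f x z"
    by (rule module_hom.add[OF 1], rule module_hom.scale[OF 1])
  show "f x (y + z) = f x y + f x z" "f x (c *s y) = c * f x y"
    by (rule module_hom.add[OF 2], rule module_hom.scale[OF 2])
qed

text \<open>Every vector counts as singular, so a line carries \<open>q\<close> singular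
  vectors.\<close>

lemma isotropy_space_alternating:
  assumes "alternating_form f" "nondegenerate f"
  shows "isotropy_space scale Basis q f (\<lambda>_. True) q"
proof -
  have bil: "bilinear_form f" and alt: "f x x = 0" for x
    using assms(1) by (auto simp: alternating_form_def)
  have skew: "f x y + f y x = 0" for x y
    using alt[of "x + y"] unfolding bilinear_formD(1,3)[OF bil] by (simp add: alt add.commute)
  have sym: "f x y = 0 \<longleftrightarrow> f y x = 0" for x y
    using skew[of x y] by auto
  show ?thesis
  proof
    fix x assume "\<And>v. f v x = 0"
    then show "x = 0" using assms(2) sym unfolding nondegenerate_def by blast
  qed (use sym in \<open>auto simp: bilinear_formD[OF bil] alt q_eq\<close>)
qed

text \<open>Additivity in the second argument comes from additivity of the power map. Singular
  vectors on a line are the solutions of a trace equation, which gives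
  \<open>e = q0\<close>.\<close>

lemma isotropy_space_hermitian:
  assumes "hermitian_form f" "nondegenerate f"
  obtains q0 where "q0\<^sup>2 = q" "isotropy_space scale Basis q f (\<lambda>x. f x x = 0) q0"
proof -
  obtain q0 where q0: "q0\<^sup>2 = CARD('a)" and herm: "f y x = f x y ^ q0"
    and lin: "Vector_Spaces.linear scale (*) (\<lambda>x. f x y)" for x y
    using assms(1) unfolding hermitian_form_def by blast
  have q0_pos: "q0 > 0" using q0 by (cases q0) auto
  have hom: "module_hom scale (*) (\<lambda>x. f x z)" for z
    using lin by (rule Vector_Spaces.linear.axioms)
  have addl: "f (x + y) z = f x z + f y z" and scl: "f (c *s x) z = c * f x z" for x y z c
    by (rule module_hom.add[OF hom], rule module_hom.scale[OF hom])
  have addr: "f x (y + z) = f x y + f x z" for x y z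
    unfolding herm[of x] addl by (rule add_power_square_root_card[OF q0])
  have scr: "f x (c *s y) = (c * f y x) ^ q0" for x y c
    by (subst herm) (simp only: scl)
  have sym: "f x y = 0 \<longleftrightarrow> f y x = 0" for x y
    using herm[of x y] herm[of y x] q0_pos by auto
  have "isotropy_space scale Basis q f (\<lambda>x. f x x = 0) q0"
  proof
    fix x assume "\<And>v. f v x = 0"
    then show "x = 0" using assms(2) sym unfolding nondegenerate_def by blast
  next
    fix x v assume x: "f x x = 0" and v: "f v x \<noteq> 0"
    \<comment> \<open>\<open>f v v\<close> is fixed by the power map by Hermitian symmetry, as
      \<open>card_trace_fibre\<close> demands.\<close>
    have "f (v + c *s x) (v + c *s x) = f v v + (c * f x v + (c * f x v) ^ q0)" for c
      using x q0_pos by (simp add: addl addr scl scr[of _ _ x] power_0_left algebra_simps)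
    then show "card {c. f (v + c *s x) (v + c *s x) = 0} = q0"
      using card_trace_fibre[OF q0, of "f x v" "f v v"] v sym[of v x] herm[of v v] by simp
  next
    show "f 0 0 = 0" using scl[of 0 0 0] by simp
  next
    fix x c assume "f x x = 0"
    then show "f (c *s x) (c *s x) = 0" using q0_pos by (simp add: scl scr)
  next
    fix x y assume "f x x = 0" "f y y = 0" "f x y = 0"
    then show "f (x + y) (x + y) = 0" using sym[of x y] by (simp add: addl addr)
  qed (use sym in \<open>simp_all add: addl addr scl\<close>)
  then show ?thesis using that q0 q_eq by simp
qed

text \<open>Along a singular direction \<open>x\<close> the value of \<open>g\<close> is affine in
  \<open>c\<close> with slope \<open>polar_form g v x\<close>, hence has exactly one zero.\<close>

lemma isotropy_space_quadratic:
  assumes "quadratic_form g" "nonsingular g"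
  shows "isotropy_space scale Basis q (polar_form g) (\<lambda>x. g x = 0) 1"
proof -
  have bil: "bilinear_form (polar_form g)" and g_scale: "g (c *s x) = c\<^sup>2 * g x" for c x
    using assms(1) by (auto simp: quadratic_form_def)
  have g_add: "g (x + y) = polar_form g x y + g x + g y" for x y
    by (simp add: polar_form_def)
  have sym: "polar_form g x y = polar_form g y x" for x y
    by (simp add: polar_form_def add.commute)
  show ?thesis
  proof
    fix x assume "g x = 0" "\<And>v. polar_form g v x = 0"
    then show "x = 0" using assms(2) sym unfolding nonsingular_def by metis
  next
    fix x v assume x: "g x = 0" and v: "polar_form g v x \<noteq> 0"
    have "g (v + c *s x) = c * polar_form g v x + g v" for c
      using x by (simp add: g_add g_scale bilinear_formD[OF bil])
    then have "{c. g (v + c *s x) = 0} = {- g v / polar_form g v x}"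
      using v by (auto simp: field_simps eq_neg_iff_add_eq_0)
    then show "card {c. g (v + c *s x) = 0} = 1" by simp
  next
    fix x assume x: "g x = 0"
    have "x + x = (1 + 1) *s x" by (simp only: scale_left_distrib scale_one)
    then show "polar_form g x x = 0" using x by (simp add: polar_form_def g_scale)
  next
    show "g 0 = 0" using g_scale[of 0 0] by simp
  next
    fix x y z show "polar_form g (x + y) z = polar_form g x z + polar_form g y z"
      "polar_form g x (y + z) = polar_form g x y + polar_form g x z"
      by (rule bilinear_formD[OF bil])+
  next
    fix c x z show "polar_form g (c *s x) z = c * polar_form g x z" by (rule bilinear_formD[OF bil])
  qed (simp_all add: sym g_scale g_add)
qed

text \<open>On a totally singular subspace the polar form vanishes, because sums are singular as
  well.\<close>

lemma totally_singular_eq_isotropic: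
  assumes "quadratic_form g" "nonsingular g"
  shows "totally_singular_subspaces g = isotropy_space.isotropic scale (polar_form g) (\<lambda>x. g x = 0)"
  unfolding isotropy_space.isotropic_def[OF isotropy_space_quadratic[OF assms]] totally_singular_subspaces_def
  by (auto simp: polar_form_def subspace_add)

text \<open>The equation for \<open>e\<close> says that \<open>e\<close> is \<open>q\<close> to the
  power \<open>1 + 2 * r + \<epsilon> - n\<close>, with \<open>n\<close> the ambient dimension. The
  exponent is 1, 1/2 or 0 for alternating, Hermitian and quadratic forms.\<close>

lemma polar_space_isotropic:
  assumes "polar_space Q r P"
  obtains f sing e where "isotropy_space scale Basis q f sing e" "P = isotropy_space.isotropic scale f sing"
    "real e / real q * real q ^ dim (UNIV :: 'v set) = real q powr (2 * real r + epsilon Q)"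
proof -
  have q0: "real q > 0" using q_ge_2 by simp
  have n: "dim (UNIV :: 'v set) = ambient_dim Q r" using assms by (simp add: polar_space_def)
  have e: "real e / real q * real q ^ dim (UNIV :: 'v set) = real q powr (2 * real r + epsilon Q)"
    if "real e = real q powr (1 + 2 * real r + epsilon Q - real (ambient_dim Q r))" for e
  proof -
    have "real q powr (-1) = inverse (real q)" using q0 by (simp add: powr_minus)
    then have "real e / real q * real q ^ dim (UNIV :: 'v set)
        = real q powr (1 + 2 * real r + epsilon Q - real (ambient_dim Q r))
          * real q powr (-1) * real q powr real (ambient_dim Q r)"
      using q0 by (simp only: that n powr_realpow divide_inverse)
    also have "\<dots> = real q powr (2 * real r + epsilon Q)"
      by (simp only: powr_add[symmetric]) simp
    finally show ?thesis .
  qed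
  consider f where "alternating_form f" "nondegenerate f" "P = totally_isotropic_subspaces f" "Q = Symplectic"
    | f where "hermitian_form f" "nondegenerate f" "P = totally_isotropic_subspaces f"
        "Q = Hermitian_plus \<or> Q = Hermitian_minus"
    | g where "quadratic_form g" "nonsingular g" "P = totally_singular_subspaces g"
        "Q = Hyperbolic \<or> Q = Parabolic \<or> Q = Elliptic"
    using assms by (cases Q) (auto simp: polar_space_def symplectic_space_def hermitian_space_def orthogonal_space_def)
  then show ?thesis
  proof cases
    case 1
    note iso = isotropy_space_alternating[OF 1(1,2)]
    show ?thesis
      by (rule that[OF iso _ e])
        (use q0 in \<open>auto simp: 1(3,4) isotropy_space.isotropic_def[OF iso] totally_isotropic_subspaces_def\<close>)
  next
    case 2
    obtain q0 where sq: "q0\<^sup>2 = q" and iso: "isotropy_space scale Basis q f (\<lambda>x. f x x = 0) q0"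
      using isotropy_space_hermitian[OF 2(1,2)] by blast
    have "real q0 = sqrt (real q)" unfolding sq[symmetric] by simp
    then have "real q0 = real q powr (1 / 2)" using q0 by (simp add: powr_half_sqrt)
    moreover have "1 + 2 * real r + epsilon Q - real (ambient_dim Q r) = 1 / 2"
      using 2(4) by auto
    ultimately have "real q0 = real q powr (1 + 2 * real r + epsilon Q - real (ambient_dim Q r))"
      by (simp only:)
    then show ?thesis
      by (intro that[OF iso _ e])
        (auto simp: 2(3) isotropy_space.isotropic_def[OF iso] totally_isotropic_subspaces_def)
  next
    case 3
    have "1 + 2 * real r + epsilon Q - real (ambient_dim Q r) = 0"
      using 3(4) by auto
    then show ?thesis
      by (intro that[OF isotropy_space_quadratic[OF 3(1,2)] _ e])
        (use q0 in \<open>auto simp: 3(3) totally_singular_eq_isotropic[OF 3(1,2)]\<close>)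
  qed
qed

section \<open>Counting blocks\<close>

lemma polar_space_subspace:
  assumes "polar_space Q r P" "X \<in> P"
  shows "subspace X"
  using polar_space_isotropic[OF assms(1)] isotropy_space.isotropic_subspace assms(2) by metis

lemma polar_space_mono:
  assumes "polar_space Q r P" "X \<in> P" "subspace Y" "Y \<subseteq> X"
  shows "Y \<in> P"
  using polar_space_isotropic[OF assms(1)] isotropy_space.isotropic_mono assms(2-4) by metis

lemma card_polar_space_above:
  assumes P: "polar_space Q r P" and "J \<in> P" "dim J \<le> t" "t \<le> r"
  shows "real (card {X \<in> P. J \<subseteq> X \<and> dim X = t}) = polar_binomial q Q (r - dim J) (t - dim J)"
proof -
  obtain f sing e where iso: "isotropy_space scale Basis q f sing e"
      "P = isotropy_space.isotropic scale f sing"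
      "real e / real q * real q ^ dim (UNIV :: 'v set) = real q powr (2 * real r + epsilon Q)"
    using polar_space_isotropic[OF P] .
  have "r = Max (dim ` P)" using P by (simp add: polar_space_def polar_rank_def)
  then show ?thesis
    using isotropy_space.card_isotropic_above[OF iso(1) _ iso(3)] assms(2-4) unfolding iso(2) by blast
qed

text \<open>Pairs \<open>T \<subseteq> B\<close> with \<open>J \<subseteq> T\<close> and
  \<open>dim T = t\<close> are counted twice: each \<open>T\<close> lies in \<open>lam\<close>
  blocks, and each block above \<open>J\<close> contains
  \<open>gauss_binomial q (k - dim J) (t - dim J)\<close> such \<open>T\<close>.\<close>

lemma card_blocks_above:
  assumes P: "polar_space Q r P" and D: "polar_design P t k lam D" and "t \<le> k" "k \<le> r"
    and J: "J \<in> P" "dim J \<le> t"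
  shows "real (card {B \<in> D. J \<subseteq> B})
       = real lam * polar_binomial q Q (r - dim J) (t - dim J) / gauss_binomial q (k - dim J) (t - dim J)"
proof -
  let ?T = "{T \<in> P. J \<subseteq> T \<and> dim T = t}" and ?D = "{B \<in> D. J \<subseteq> B}"
  have fin: "finite \<X>" for \<X> :: "'v set set"
    by (rule finite_subset[of _ UNIV]) (simp_all add: Finite_Set.finite_set)
  have block: "B \<in> P" "dim B = k" if "B \<in> D" for B
    using D that by (auto simp: polar_design_def)
  have "(\<Sum>T\<in>?T. \<Sum>B\<in>{B. B \<in> ?D \<and> T \<subseteq> B}. 1 :: real) = (\<Sum>T\<in>?T. real lam)"
  proof (intro sum.cong refl)
    fix T assume T: "T \<in> ?T"
    then have "{B. B \<in> ?D \<and> T \<subseteq> B} = {B \<in> D. T \<subseteq> B}" by auto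
    then show "(\<Sum>B\<in>{B. B \<in> ?D \<and> T \<subseteq> B}. 1 :: real) = real lam"
      using T D by (simp add: polar_design_def)
  qed
  moreover have "(\<Sum>T\<in>?T. \<Sum>B\<in>{B. B \<in> ?D \<and> T \<subseteq> B}. 1 :: real) = (\<Sum>B\<in>?D. \<Sum>T\<in>{T. T \<in> ?T \<and> T \<subseteq> B}. 1)"
    by (rule sum.swap_restrict) (rule fin)+
  moreover have "\<dots> = (\<Sum>B\<in>?D. gauss_binomial q (k - dim J) (t - dim J))"
  proof (intro sum.cong refl)
    fix B assume B: "B \<in> ?D"
    have "{T. T \<in> ?T \<and> T \<subseteq> B} = {X. subspace X \<and> J \<subseteq> X \<and> X \<subseteq> B \<and> dim X = t}"
      using polar_space_subspace[OF P] polar_space_mono[OF P, of B] block[of B] B by blast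
    then show "(\<Sum>T\<in>{T. T \<in> ?T \<and> T \<subseteq> B}. 1 :: real) = gauss_binomial q (k - dim J) (t - dim J)"
      using card_subspaces_between[of J B t] polar_space_subspace[OF P] block[of B] B J by simp
  qed
  ultimately have "real lam * real (card ?T) = real (card ?D) * gauss_binomial q (k - dim J) (t - dim J)"
    by (simp add: mult.commute)
  moreover have "gauss_binomial q (k - dim J) (t - dim J) > 0"
    using assms(3) by (intro gauss_binomial_pos q_ge_2) auto
  ultimately show ?thesis
    using card_polar_space_above[OF P J] assms(3,4) by (simp add: field_simps)
qed

lemma sum_intersection_numbers:
  assumes P: "polar_space Q r P" and D: "polar_design P t k lam D" and "t \<le> k" "k \<le> r"
    and S: "S \<in> P" and i: "i \<le> t"
  shows "(\<Sum>j\<le>k. gauss_binomial q j i * real (card {B \<in> D. dim (B \<inter> S) = j}))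
       = gauss_binomial q (dim S) i * (real lam * polar_binomial q Q (r - i) (t - i) / gauss_binomial q (k - i) (t - i))"
proof -
  let ?J = "{J. subspace J \<and> J \<subseteq> S \<and> dim J = i}"
  let ?L = "real lam * polar_binomial q Q (r - i) (t - i) / gauss_binomial q (k - i) (t - i)"
  have fin: "finite \<X>" for \<X> :: "'v set set"
    by (rule finite_subset[of _ UNIV]) (simp_all add: Finite_Set.finite_set)
  have block: "B \<in> P" "dim B = k" if "B \<in> D" for B
    using D that by (auto simp: polar_design_def)
  have sub: "real (card {J. subspace J \<and> J \<subseteq> W \<and> dim J = i}) = gauss_binomial q (dim W) i" if "subspace W" for W
    using card_subspaces_between[of "{0}" W i] that subspace_0 by (simp add: subspace_single_0 cong: conj_cong)
  have "(\<Sum>J\<in>?J. \<Sum>B\<in>{B. B \<in> D \<and> J \<subseteq> B}. 1 :: real) = (\<Sum>J\<in>?J. ?L)"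
  proof (intro sum.cong refl)
    fix J assume J: "J \<in> ?J"
    then have "J \<in> P" using polar_space_mono[OF P S] by blast
    then show "(\<Sum>B\<in>{B. B \<in> D \<and> J \<subseteq> B}. 1 :: real) = ?L"
      using card_blocks_above[OF P D assms(3,4), of J] J i by simp
  qed
  moreover have "(\<Sum>J\<in>?J. \<Sum>B\<in>{B. B \<in> D \<and> J \<subseteq> B}. 1 :: real) = (\<Sum>B\<in>D. \<Sum>J\<in>{J. J \<in> ?J \<and> J \<subseteq> B}. 1)"
    by (rule sum.swap_restrict) (rule fin)+
  moreover have "\<dots> = (\<Sum>B\<in>D. gauss_binomial q (dim (B \<inter> S)) i)"
  proof (intro sum.cong refl)
    fix B assume B: "B \<in> D"
    have "{J. J \<in> ?J \<and> J \<subseteq> B} = {J. subspace J \<and> J \<subseteq> B \<inter> S \<and> dim J = i}" by auto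
    then show "(\<Sum>J\<in>{J. J \<in> ?J \<and> J \<subseteq> B}. 1 :: real) = gauss_binomial q (dim (B \<inter> S)) i"
      using sub[of "B \<inter> S"] subspace_inter polar_space_subspace[OF P] S block(1)[OF B] by simp
  qed
  \<comment> \<open>Blocks are grouped by the dimension of their intersection with \<open>S\<close>,
    which is at most \<open>k\<close>.\<close>
  moreover have "\<dots> = (\<Sum>j\<le>k. \<Sum>B\<in>{B \<in> D. dim (B \<inter> S) = j}. gauss_binomial q (dim (B \<inter> S)) i)"
  proof (rule sum.group[symmetric])
    show "(\<lambda>B. dim (B \<inter> S)) ` D \<subseteq> {..k}"
      using block(2) dim_subset[of "B \<inter> S" B for B] by fastforce
  qed (use fin in auto)
  moreover have "\<dots> = (\<Sum>j\<le>k. gauss_binomial q j i * real (card {B \<in> D. dim (B \<inter> S) = j}))"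
    by (intro sum.cong refl) simp
  ultimately show ?thesis
    using sub[of S] polar_space_subspace[OF P S] by simp
qed

end

theorem theorem12:
  fixes scale :: "'a::{field,finite} \<Rightarrow> 'v::ab_group_add \<Rightarrow> 'v"
    and Basis :: "'v set"
    and P D :: "'v set set"
    and S :: "'v set"
    and Q :: polar_type
    and q r t k s lam i :: nat
    and \<alpha> \<Lambda> :: "nat \<Rightarrow> real"
  assumes "finite_dimensional_vector_space scale Basis"
    and "q = CARD('a)"
    and "r \<ge> 1"
    and "finite_dimensional_vector_space.polar_space scale Q r P"
    and "t \<le> k" and "k \<le> r"
    and "finite_dimensional_vector_space.polar_design scale P t k lam D"
    and "S \<in> P" and "s = vector_space.dim scale S"
    and "\<And>j. j \<le> k \<Longrightarrow> \<alpha> j = real (card {B \<in> D. vector_space.dim scale (B \<inter> S) = j})"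
    and "\<And>j. j \<le> t \<Longrightarrow>
          \<Lambda> j = real lam * polar_binomial q Q (r - j) (t - j) / gauss_binomial q (k - j) (t - j)"
    and "i \<le> t"
  shows "\<alpha> i =
      gauss_binomial q s i *
        (\<Sum>j = i..t. (-1) ^ (j - i) * real q ^ ((j - i) choose 2) *
           gauss_binomial q (s - i) (j - i) * \<Lambda> j)
    + (-1) ^ (t + 1 - i) * real q ^ ((t + 1 - i) choose 2) *
        (\<Sum>j = t + 1..k. gauss_binomial q j i * gauss_binomial q (j - i - 1) (t - i) * \<alpha> j)"
proof -
  interpret finite_field_space scale Basis q
    using assms(1,2) by (simp add: finite_field_space_def finite_field_space_axioms_def)
  have "(\<Sum>j\<le>k. gauss_binomial q j l * \<alpha> j) = gauss_binomial q s l * \<Lambda> l" if "l \<le> t" for l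
    using sum_intersection_numbers[OF assms(4,7,5,6,8) that] assms(9-11) that by simp
  then have "(\<Sum>l = i..t. (-1) ^ (l - i) * real q ^ ((l - i) choose 2) * gauss_binomial q l i *
        (\<Sum>j\<le>k. gauss_binomial q j l * \<alpha> j))
      = (\<Sum>l = i..t. (-1) ^ (l - i) * real q ^ ((l - i) choose 2) *
        (gauss_binomial q s l * gauss_binomial q l i) * \<Lambda> l)"
    by (intro sum.cong) auto
  \<comment> \<open>The flag identity turns \<open>[s, l] [l, i]\<close> into
    \<open>[s, i] [s - i, l - i]\<close>, so that \<open>[s, i]\<close> leaves the sum.\<close>
  also have "\<dots> = gauss_binomial q s i *
        (\<Sum>l = i..t. (-1) ^ (l - i) * real q ^ ((l - i) choose 2) * gauss_binomial q (s - i) (l - i) * \<Lambda> l)"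
    unfolding sum_distrib_left
    by (intro sum.cong refl, subst gauss_binomial_trinomial[OF q_ge_2]) auto
  \<comment> \<open>Truncated inversion gives \<open>\<alpha> i\<close> plus a tail with sign
    \<open>(-1) ^ (t - i)\<close>; moving the tail across turns the exponent into
    \<open>t + 1 - i\<close>.\<close>
  finally show ?thesis
    using gauss_binomial_partial_inversion[OF q_ge_2 assms(12,5), of \<alpha>] assms(12)
    by (simp add: Suc_diff_le)
qed

end
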